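(* For every integer $h\ge 2$ there is a function $g_h$ assigning to each $\varepsilon>0$ a positive integer $g_h(\varepsilon)$, with $g_h(\varepsilon)\ll \varepsilon^{-1}$ as $\varepsilon\to 0^+$ (the implied constant depending only on $h$), such that for every $\varepsilon>0$ there exists a $B_h[g]$ sequence $A$ with $g=g_h(\varepsilon)$ satisfying $A(x)\gg x^{1/h-\varepsilon}$.
   Context: Sequences of integers are identified with sets of integers. For an integer $h\ge 2$, a set $A$ of integers and an integer $n$, let $r_{h,A}(n)=|\{(a_1,\ldots,a_h) : n=a_1+\cdots+a_h,\ a_1\le\cdots\le a_h,\ a_i\in A\}|$. The set $A$ is called a $B_h[g]$ sequence if every integer $n$ satisfies $r_{h,A}(n)\le g$. The counting function is $A(x)=|A\cap[1,x]|$. The notation $A(x)\gg f(x)$ means that there are a constant $c>0$ (which may depend on $A$, $h$, $\varepsilon$) and $x_0$ such that $A(x)\ge c f(x)$ for all $x\ge x_0$. *)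

theory Defs
  imports Complex_Main "HOL-Library.Landau_Symbols"
begin

definition reps :: "nat \<Rightarrow> int set \<Rightarrow> int \<Rightarrow> int list set" where
  "reps h A n = {as. length as = h \<and> sorted as \<and> set as \<subseteq> A \<and> sum_list as = n}"

text \<open>
  Since \<open>A\<close> may contain negative integers, there may be infinitely many representations of \<open>n\<close>;
  \<^const>\<open>card\<close> is \<open>0\<close> on infinite sets, so finiteness is demanded explicitly.
\<close>

definition B_seq :: "nat \<Rightarrow> nat \<Rightarrow> int set \<Rightarrow> bool" where
  "B_seq h g A \<longleftrightarrow> (\<forall>n. finite (reps h A n) \<and> card (reps h A n) \<le> g)"

definition counting :: "int set \<Rightarrow> real \<Rightarrow> nat" where
  "counting A x = card {a \<in> A. 1 \<le> a \<and> real_of_int a \<le> x}"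

end

theory Submission
  imports Defs "HOL-Probability.Probability"
begin

text \<open>
  Put \<open>\<gamma> = 1 / h - \<epsilon>\<close> and cut the positive integers into the classes on which \<open>\<lfloor>x powr \<gamma>\<rfloor>\<close> is
  constant. The set \<open>A\<close> contains exactly one element of each class, except for finitely many
  classes, so \<open>A\<close> has about \<open>x powr \<gamma>\<close> elements up to \<open>x\<close> whatever the choices are
  (\<open>counting_ge_of_transversal\<close>). The elements are drawn independently and uniformly, and it remains
  to show that with positive probability no number has many representations.

  A class near \<open>x\<close> has about \<open>x powr (1 - \<gamma>)\<close> elements, so a given \<open>x\<close> is drawn with probability
  about \<open>x powr (\<gamma> - 1)\<close>. The expected number of representations of \<open>n\<close> as a sum of \<open>l\<close> drawn
  elements is \<open>O(n powr (l * \<gamma> - 1))\<close> (\<open>sum_class_weight_reps_le\<close>), which is a negative power of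
  \<open>n\<close> for every \<open>l \<le> h\<close>. Representations that share elements are correlated, but pairwise disjoint
  ones occur together with at most the product of their probabilities. So the expected number of
  \<open>k\<close>-tuples of pairwise disjoint representations is at most the \<open>k\<close>-th power of the above. As soon as
  \<open>k * (1 - l * \<gamma>) \<ge> 3\<close>, the sum of these expectations over all large \<open>n\<close> is less than 1, and a
  choice without any such tuple exists (\<open>exists_transversal_few_disjoint_reps\<close>). For \<open>l < h\<close> the
  value \<open>k = 3 * h\<close> suffices; for \<open>l = h\<close> the condition reads \<open>k \<ge> 3 / (h * \<epsilon>)\<close>.

  Finally, a bound on the size of disjoint families yields a bound on the number of all
  representations, by induction on the length: every representation of length \<open>l + 1\<close> shares an
  element with a fixed maximal disjoint family, and removing that element leaves a representation of
  length \<open>l\<close> (\<open>B_seq_Suc\<close>). Each length multiplies the bound by \<open>l * k\<close>, and since only the last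
  \<open>k\<close> depends on \<open>\<epsilon>\<close>, the final bound is a constant depending on \<open>h\<close> times \<open>1 / \<epsilon>\<close>.
\<close>

section \<open>Independent choices avoiding unlikely configurations\<close>

text \<open>
  The union bound, for independent draws \<open>\<omega> m\<close> with law \<open>P m\<close>: the event that all points of
  \<open>X d\<close> are drawn has probability at most the product of their individual probabilities. There
  is equality if these points belong to different draws, and the event is impossible if two of them
  belong to the same draw. Grouping the events into finite packets \<open>D n\<close> lets
  countably many of them be summed with an ordinary series.
\<close>

lemma random_transversal:
  fixes P :: "nat \<Rightarrow> 'a pmf" and idx :: "'a \<Rightarrow> nat"
    and D :: "nat \<Rightarrow> 'b set" and X :: "'b \<Rightarrow> 'a set"
  assumes finD: "\<And>n. finite (D n)"
    and finX: "\<And>n d. d \<in> D n \<Longrightarrow> finite (X d)"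
    and bound: "\<And>n. (\<Sum>d\<in>D n. \<Prod>x\<in>X d. pmf (P (idx x)) x) \<le> w n"
    and w: "summable w" "suminf w < 1"
  shows "\<exists>\<omega>. (\<forall>m. \<omega> m \<in> set_pmf (P m)) \<and> (\<forall>n. \<forall>d\<in>D n. \<exists>x\<in>X d. \<omega> (idx x) \<noteq> x)"
proof -
  interpret product_prob_space "\<lambda>m. measure_pmf (P m)" UNIV
    by unfold_locales
  define M where "M = PiM UNIV (\<lambda>m. measure_pmf (P m))"
  interpret M: prob_space M
    unfolding M_def by (rule prob_space_PiM) (rule measure_pmf.prob_space_axioms)
  have space: "space M = UNIV" by (simp add: M_def space_PiM)
  define E where "E d = {\<omega>. \<forall>x\<in>X d. \<omega> (idx x) = x}" for d
  have meas: "{\<omega>. \<omega> (idx x) = x} \<in> sets M" for x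
  proof -
    have "(\<lambda>\<omega>. \<omega> (idx x)) -` {x} \<inter> space M \<in> sets M"
      unfolding M_def by (rule measurable_sets[OF measurable_component_singleton]) auto
    thus ?thesis by (simp add: space vimage_def)
  qed
  have E: "E d \<in> sets M \<and> measure M (E d) \<le> (\<Prod>x\<in>X d. pmf (P (idx x)) x)"
    if d: "finite (X d)" for d
  proof (intro conjI)
    show "E d \<in> sets M"
    proof (cases "X d = {}")
      case True
      thus ?thesis using sets.top[of M] by (simp add: E_def space)
    next
      case False
      have "E d = (\<Inter>x\<in>X d. {\<omega>. \<omega> (idx x) = x})" by (auto simp: E_def)
      thus ?thesis using meas d False by (auto intro!: sets.finite_INT)
    qed
    show "measure M (E d) \<le> (\<Prod>x\<in>X d. pmf (P (idx x)) x)"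
    proof (cases "inj_on idx (X d)")
      case True
      define J where "J = idx ` X d"
      define y where "y = the_inv_into (X d) idx"
      have y: "y (idx x) = x" if "x \<in> X d" for x
        using that True by (simp add: y_def the_inv_into_f_f)
      have "E d = prod_emb UNIV (\<lambda>m. measure_pmf (P m)) J (Pi\<^sub>E J (\<lambda>j. {y j}))"
        by (auto simp: E_def prod_emb_def J_def y PiE_iff)
      hence "measure M (E d) = (\<Prod>j\<in>J. measure (P j) {y j})"
        unfolding M_def by (simp add: measure_PiM_emb J_def d)
      also have "\<dots> = (\<Prod>x\<in>X d. pmf (P (idx x)) x)"
        unfolding J_def by (subst prod.reindex[OF True]) (simp add: y measure_pmf_single)
      finally show ?thesis by simp
    next
      case False
      then obtain x y where "x \<in> X d" "y \<in> X d" "idx x = idx y" "x \<noteq> y"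
        by (auto simp: inj_on_def)
      hence "E d = {}" unfolding E_def by (metis (mono_tags, lifting) empty_Collect_eq)
      thus ?thesis by (simp add: prod_nonneg)
    qed
  qed
  define B where "B n = (\<Union>d\<in>D n. E d)" for n
  have B: "B n \<in> sets M" "measure M (B n) \<le> w n" for n
  proof -
    show "B n \<in> sets M" unfolding B_def using finD finX E by (intro sets.finite_UN) auto
    have "measure M (B n) \<le> (\<Sum>d\<in>D n. measure M (E d))"
      unfolding B_def using E finX finD
      by (intro measure_subadditive_finite) (auto simp: M.emeasure_eq_measure)
    also have "\<dots> \<le> (\<Sum>d\<in>D n. \<Prod>x\<in>X d. pmf (P (idx x)) x)"
      using E finX by (intro sum_mono) auto
    also have "\<dots> \<le> w n" by (rule bound)
    finally show "measure M (B n) \<le> w n" .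
  qed
  have summ: "summable (\<lambda>n. measure M (B n))"
    using B(2) by (intro summable_comparison_test'[OF w(1)]) auto
  have "measure M (\<Union>n. B n) \<le> (\<Sum>n. measure M (B n))"
    using B(1) summ by (intro M.finite_measure_subadditive_countably) auto
  also have "\<dots> \<le> suminf w"
    using B(2) summ w(1) by (intro suminf_le) auto
  also have "\<dots> < 1" by (rule w(2))
  finally have less: "measure M (\<Union>n. B n) < 1" .
  \<comment> \<open>Being outside the support has probability 0, so the positive probability that is left contains
    a choice with all values in the supports.\<close>
  have supp: "AE \<omega> in M. \<forall>m. \<omega> m \<in> set_pmf (P m)"
    unfolding AE_all_countable M_def
    by (intro allI AE_PiM_component[where P = "\<lambda>z. z \<in> set_pmf (P _)"])
       (auto simp: measure_pmf.prob_space_axioms AE_measure_pmf)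
  have "\<exists>\<omega>. (\<forall>m. \<omega> m \<in> set_pmf (P m)) \<and> \<omega> \<notin> (\<Union>n. B n)"
  proof (rule ccontr)
    assume "\<not> ?thesis"
    hence "AE \<omega> in M. \<omega> \<in> (\<Union>n. B n)" using supp by (auto elim!: eventually_mono)
    hence "measure M (\<Union>n. B n) = 1" using B(1) by (subst M.prob_eq_1) auto
    thus False using less by simp
  qed
  thus ?thesis by (auto simp: B_def E_def)
qed

section \<open>Weighted sums over representations\<close>

text \<open>
  Prepending a new point \<open>x\<close> to a list multiplies its weight by \<open>p x\<close>, which contributes the
  factor \<open>sum p U\<close>; prepending one of the at most \<open>r\<close> points already present leaves the weight
  unchanged, because it runs over the set of entries. Hence the extra summand \<open>r\<close>.
\<close>

lemma sum_prod_set_lists: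
  fixes p :: "'a \<Rightarrow> real"
  assumes "finite U" and p: "\<And>x. x \<in> U \<Longrightarrow> 0 \<le> p x"
  shows "(\<Sum>as | length as = r \<and> set as \<subseteq> U. \<Prod>x\<in>set as. p x) \<le> (sum p U + real r) ^ r"
proof (induction r)
  case 0
  have "{as. length as = 0 \<and> set as \<subseteq> U} = {[]}" by auto
  thus ?case by simp
next
  case (Suc r)
  let ?L = "{as. length as = r \<and> set as \<subseteq> U}"
  let ?W = "\<lambda>as. \<Prod>x\<in>set as. p x"
  have fin: "finite ?L" using finite_lists_length_eq[OF assms(1), of r] by (simp add: conj_commute)
  have W0: "0 \<le> ?W as" if "as \<in> ?L" for as using that p by (intro prod_nonneg) auto
  have S0: "0 \<le> sum p U" using p by (intro sum_nonneg)
  have eq: "{as. length as = Suc r \<and> set as \<subseteq> U} = (\<lambda>(x, as). x # as) ` (U \<times> ?L)"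
    by (auto simp: length_Suc_conv image_iff)
  have inj: "inj_on (\<lambda>(x, as). x # as) (U \<times> ?L)" by (auto simp: inj_on_def)
  have step: "?W (x # as) \<le> p x * ?W as + (if x \<in> set as then ?W as else 0)"
    if "x \<in> U" "as \<in> ?L" for x as
    using that p[of x] W0[of as] by (auto simp: insert_absorb)
  have few: "(\<Sum>x\<in>U. if x \<in> set as then ?W as else 0) \<le> real r * ?W as" if as: "as \<in> ?L" for as
  proof -
    have "(\<Sum>x\<in>U. if x \<in> set as then ?W as else 0) = real (card (U \<inter> set as)) * ?W as"
      using assms(1) by (simp add: sum.If_cases)
    also have "\<dots> \<le> real r * ?W as"
    proof (intro mult_right_mono W0[OF as])
      have "card (U \<inter> set as) \<le> card (set as)" by (intro card_mono) auto
      also have "\<dots> \<le> r" using card_length[of as] as by simp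
      finally show "real (card (U \<inter> set as)) \<le> real r" by simp
    qed
    finally show ?thesis .
  qed
  have "(\<Sum>as | length as = Suc r \<and> set as \<subseteq> U. ?W as) = (\<Sum>as\<in>?L. \<Sum>x\<in>U. ?W (x # as))"
    unfolding eq by (subst sum.reindex[OF inj], subst sum.swap)
      (simp add: sum.cartesian_product split_def)
  also have "\<dots> \<le> (\<Sum>as\<in>?L. \<Sum>x\<in>U. p x * ?W as + (if x \<in> set as then ?W as else 0))"
    by (intro sum_mono step)
  also have "\<dots> \<le> (\<Sum>as\<in>?L. (sum p U + real r) * ?W as)"
    using few by (intro sum_mono) (simp add: sum.distrib sum_distrib_right[symmetric] distrib_right)
  also have "\<dots> = (sum p U + real r) * (\<Sum>as\<in>?L. ?W as)" by (simp add: sum_distrib_left)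
  also have "\<dots> \<le> (sum p U + real r) * (sum p U + real r) ^ r"
    using S0 by (intro mult_left_mono Suc.IH) auto
  also have "\<dots> \<le> (sum p U + real (Suc r)) * (sum p U + real (Suc r)) ^ r"
    using S0 by (intro mult_mono power_mono) auto
  finally show ?case by simp
qed

lemma le_last_if_sorted: "sorted as \<Longrightarrow> x \<in> set as \<Longrightarrow> x \<le> last as"
  by (induction as) auto

text \<open>
  No convolution of weights is needed: in a sorted representation of \<open>n\<close> the largest entry is at
  least \<open>n / l\<close>, so its weight is at most \<open>t\<close>, and it is determined by its multiplicity and by the
  list of the smaller entries. Those entries may then range over all lists, without any condition on
  their sum.
\<close>

lemma sum_prod_set_reps:
  fixes p :: "int \<Rightarrow> real" and n :: int
  assumes n: "0 < n" and l: "0 < l" and p: "\<And>x. 0 \<le> p x"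
    and top: "\<And>x. 1 \<le> x \<Longrightarrow> x \<le> n \<Longrightarrow> n \<le> int l * x \<Longrightarrow> p x \<le> t"
  shows "(\<Sum>as\<in>reps l {1..n} n. \<Prod>x\<in>set as. p x)
           \<le> real l * t * (sum p {1..n} + real l) ^ (l - 1)"
proof -
  let ?U = "{1..n}"
  let ?W = "\<lambda>as. \<Prod>x\<in>set as. p x"
  let ?L = "\<lambda>r. {as. length as = r \<and> set as \<subseteq> ?U}"
  let ?T = "SIGMA c:{1..l}. ?L (l - c)"
  have t0: "0 \<le> t" using top[of n] p[of n] n l by (smt (verit) mult_le_cancel_right1 of_nat_0_less_iff)
  have S0: "0 \<le> sum p ?U" using p by (intro sum_nonneg)
  have finL: "finite (?L r)" for r
    using finite_lists_length_eq[of ?U r] by (simp add: conj_commute)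
  \<comment> \<open>Multiplicity of the largest entry, and the smaller entries.\<close>
  define f where "f as = (length (filter (\<lambda>x. last as = x) as), filter (\<lambda>x. last as \<noteq> x) as)"
    for as :: "int list"
  have split: "as = snd (f as) @ replicate (fst (f as)) (last as)" if "sorted as" for as :: "int list"
  proof -
    have "replicate (fst (f as)) (last as) = filter (\<lambda>x. last as = x) as"
      unfolding f_def fst_conv by (rule replicate_length_filter)
    moreover have "sorted (snd (f as) @ replicate (fst (f as)) (last as))"
      using that le_last_if_sorted[OF that]
      by (auto simp: sorted_append f_def sorted_filter[of "\<lambda>x. x", simplified])
    moreover have "mset (snd (f as)) + mset (filter (\<lambda>x. last as = x) as) = mset as"
      using multiset_partition[of "mset as" "\<lambda>x. last as = x"] by (simp add: f_def add.commute)
    ultimately have "sort as = snd (f as) @ replicate (fst (f as)) (last as)"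
      by (intro properties_for_sort) (simp_all only: mset_append)
    thus ?thesis using that by (simp add: sort_key_id_if_sorted)
  qed
  have last: "last as \<in> set as" "fst (f as) > 0" "fst (f as) \<le> l"
      "int (fst (f as)) * last as = n - sum_list (snd (f as))"
      "f as \<in> ?T" if as: "as \<in> reps l ?U n" for as
  proof -
    from as have a: "length as = l" "sorted as" "set as \<subseteq> ?U" "sum_list as = n"
      by (auto simp: reps_def)
    show la: "last as \<in> set as" using a(1) l by auto
    thus c0: "fst (f as) > 0" by (auto simp: f_def filter_empty_conv)
    show c1: "fst (f as) \<le> l" using a(1) by (auto simp: f_def)
    have "n = sum_list (snd (f as) @ replicate (fst (f as)) (last as))"
      using split[OF a(2)] a(4) by simp
    thus "int (fst (f as)) * last as = n - sum_list (snd (f as))"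
      by (simp add: sum_list_replicate)
    have "l = length (snd (f as) @ replicate (fst (f as)) (last as))"
      using split[OF a(2)] a(1) by simp
    hence "length (snd (f as)) = l - fst (f as)" by simp
    moreover have "set (snd (f as)) \<subseteq> ?U" using a(3) by (auto simp: f_def)
    ultimately show "f as \<in> ?T" using c0 c1 by (cases "f as") auto
  qed
  have inj: "inj_on f (reps l ?U n)"
  proof (rule inj_onI)
    fix as bs assume as: "as \<in> reps l ?U n" and bs: "bs \<in> reps l ?U n" and e: "f as = f bs"
    have "int (fst (f as)) * last as = int (fst (f as)) * last bs"
      using last(4)[OF as] last(4)[OF bs] e by simp
    hence "last as = last bs" using last(2)[OF as] by simp
    thus "as = bs" using split[of as] split[of bs] as bs e by (simp add: reps_def)
  qed
  have W: "?W as \<le> t * ?W (snd (f as))" if as: "as \<in> reps l ?U n" for as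
  proof -
    from as have a: "length as = l" "sorted as" "set as \<subseteq> ?U" "sum_list as = n"
      by (auto simp: reps_def)
    have "sum_list as \<le> sum_list (map (\<lambda>_. last as) as)"
      using sum_list_mono[of as "\<lambda>x. x" "\<lambda>_. last as"] le_last_if_sorted[OF a(2)] by simp
    hence "n \<le> int l * last as" using a by (simp add: sum_list_triv)
    hence pt: "p (last as) \<le> t" using last(1)[OF as] a(3) by (intro top) auto
    have "set as = insert (last as) (set (snd (f as)))" using last(1)[OF as] by (auto simp: f_def)
    moreover have "last as \<notin> set (snd (f as))" by (auto simp: f_def)
    ultimately have "?W as = p (last as) * ?W (snd (f as))" by simp
    also have "\<dots> \<le> t * ?W (snd (f as))" using pt p by (intro mult_right_mono prod_nonneg) auto
    finally show ?thesis .
  qed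
  have "(\<Sum>as\<in>reps l ?U n. ?W as) \<le> (\<Sum>as\<in>reps l ?U n. t * ?W (snd (f as)))"
    by (intro sum_mono W)
  also have "\<dots> = (\<Sum>y\<in>f ` reps l ?U n. t * ?W (snd y))"
    by (simp add: sum.reindex[OF inj])
  also have "\<dots> \<le> (\<Sum>y\<in>?T. t * ?W (snd y))"
  proof (intro sum_mono2)
    show "finite ?T" using finL by auto
    show "f ` reps l ?U n \<subseteq> ?T" using last(5) by (rule image_subsetI)
  qed (use t0 p in \<open>auto intro!: mult_nonneg_nonneg prod_nonneg\<close>)
  also have "\<dots> = (\<Sum>c\<in>{1..l}. t * (\<Sum>as\<in>?L (l - c). ?W as))"
    using finL by (simp add: sum_distrib_left sum.Sigma split_def)
  also have "\<dots> \<le> (\<Sum>c\<in>{1..l}. t * (sum p ?U + real l) ^ (l - 1))"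
  proof (intro sum_mono mult_left_mono t0)
    fix c assume c: "c \<in> {1..l}"
    have "(\<Sum>as\<in>?L (l - c). ?W as) \<le> (sum p ?U + real (l - c)) ^ (l - c)"
      using p by (intro sum_prod_set_lists) auto
    also have "\<dots> \<le> (sum p ?U + real l) ^ (l - c)"
      using S0 by (intro power_mono) auto
    also have "\<dots> \<le> (sum p ?U + real l) ^ (l - 1)"
      using S0 l c by (intro power_increasing) auto
    finally show "(\<Sum>as\<in>?L (l - c). ?W as) \<le> (sum p ?U + real l) ^ (l - 1)" .
  qed
  finally show ?thesis by (simp add: mult.assoc)
qed

section \<open>From disjoint representations to all representations\<close>

lemma B_seq_0: "B_seq 0 1 A"
proof -
  have "reps 0 A n \<subseteq> {[]}" for n by (auto simp: reps_def)
  thus ?thesis unfolding B_seq_def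
    by (metis card_mono finite.emptyI finite_insert finite_subset is_singletonI is_singleton_altdef)
qed

text \<open>
  Take a maximal family of pairwise disjoint representations of \<open>n\<close>. It has fewer than \<open>k\<close>
  members, hence at most \<open>Suc l * k\<close> entries, and by maximality every representation contains one of
  these entries. Removing such an entry \<open>a\<close> leaves a representation of \<open>n - a\<close> of length \<open>l\<close>, and
  there are at most \<open>g\<close> of those.
\<close>

lemma B_seq_Suc:
  assumes B: "B_seq l g A"
    and no: "\<And>n d. (\<And>i. i < k \<Longrightarrow> d i \<in> reps (Suc l) A n) \<Longrightarrow>
       (\<And>i j. i < k \<Longrightarrow> j < k \<Longrightarrow> i \<noteq> j \<Longrightarrow> set (d i) \<inter> set (d j) = {}) \<Longrightarrow> False"
  shows "B_seq (Suc l) (Suc l * k * g) A"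
  unfolding B_seq_def
proof
  fix n
  let ?R = "reps (Suc l) A n"
  define Q where "Q D \<longleftrightarrow> D \<subseteq> ?R \<and> finite D \<and> disjoint_family_on set D" for D
  have small: "card D < k" if "Q D" for D
  proof (rule ccontr)
    assume "\<not> card D < k"
    then obtain D' where D': "D' \<subseteq> D" "card D' = k"
      by (meson linorder_not_less obtain_subset_with_card_n)
    have "finite D'" using D' that by (auto simp: Q_def intro: finite_subset)
    then obtain d where d: "bij_betw d {..<k} D'"
      using ex_bij_betw_nat_finite[of D'] D'(2) by (auto simp: lessThan_atLeast0)
    have dD: "d i \<in> D'" if "i < k" for i using d that by (auto simp: bij_betw_def)
    show False
    proof (rule no[of d])
      show "d i \<in> ?R" if "i < k" for i using dD[OF that] D' \<open>Q D\<close> by (auto simp: Q_def)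
      show "set (d i) \<inter> set (d j) = {}" if "i < k" "j < k" "i \<noteq> j" for i j
      proof -
        have "d i \<noteq> d j" using d that by (auto simp: bij_betw_def inj_on_def)
        thus ?thesis using dD[OF that(1)] dD[OF that(2)] D'(1) \<open>Q D\<close>
          unfolding Q_def disjoint_family_on_def by blast
      qed
    qed
  qed
  have "Q {}" by (simp add: Q_def disjoint_family_on_def)
  then obtain D where D: "Q D" and max: "\<And>D'. Q D' \<Longrightarrow> card D' \<le> card D"
    using ex_has_greatest_nat[of Q "{}" card k] small by (metis less_imp_le)
  define Y where "Y = (\<Union>as\<in>D. set as)"
  have finY: "finite Y" using D by (auto simp: Y_def Q_def)
  have cardY: "card Y \<le> Suc l * k"
  proof -
    have "card Y \<le> (\<Sum>as\<in>D. card (set as))"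
      unfolding Y_def using D by (intro card_UN_le) (auto simp: Q_def)
    also have "\<dots> \<le> (\<Sum>as\<in>D. Suc l)"
    proof (intro sum_mono)
      fix as assume "as \<in> D"
      hence "length as = Suc l" using D by (auto simp: Q_def reps_def)
      thus "card (set as) \<le> Suc l" using card_length[of as] by simp
    qed
    also have "\<dots> \<le> Suc l * k" using mult_le_mono2[of "card D" k "Suc l"] small[OF D] by (simp add: mult.commute del: mult_Suc)
    finally show ?thesis .
  qed
  have sub: "?R \<subseteq> (\<Union>a\<in>Y. insort a ` reps l A (n - a))"
  proof
    fix as assume as: "as \<in> ?R"
    have "set as \<inter> Y \<noteq> {}"
    proof
      assume dis: "set as \<inter> Y = {}"
      have ne: "set as \<noteq> {}" using as by (auto simp: reps_def)
      have "as \<notin> D"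
      proof
        assume "as \<in> D"
        hence "set as \<subseteq> Y" unfolding Y_def by (rule UN_upper)
        thus False using dis ne by (simp add: Int_absorb2)
      qed
      moreover from this have "Q (insert as D)"
        using D as dis unfolding Q_def Y_def by (simp add: disjoint_family_on_insert)
      ultimately show False using max[of "insert as D"] D by (auto simp: Q_def)
    qed
    then obtain a where a: "a \<in> set as" "a \<in> Y" by blast
    have so: "sorted as" using as by (simp add: reps_def)
    have "as = insort a (remove1 a as)"
      using insort_remove1[OF a(1) so] by (rule sym)
    moreover have "remove1 a as \<in> reps l A (n - a)"
    proof -
      have "sum_list (remove1 a as) = n - a"
        using as a sum_list_map_remove1[of a as id] by (simp add: reps_def)
      thus ?thesis using as a set_remove1_subset[of a as]
        by (auto simp: reps_def length_remove1 sorted_remove1)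
    qed
    ultimately show "as \<in> (\<Union>a\<in>Y. insort a ` reps l A (n - a))" using a by blast
  qed
  have fin: "finite (reps l A m)" "card (reps l A m) \<le> g" for m
    using B by (auto simp: B_seq_def)
  have finU: "finite (\<Union>a\<in>Y. insort a ` reps l A (n - a))" using finY fin by auto
  have "card ?R \<le> card (\<Union>a\<in>Y. insort a ` reps l A (n - a))" by (rule card_mono[OF finU sub])
  also have "\<dots> \<le> (\<Sum>a\<in>Y. card (insort a ` reps l A (n - a)))" by (rule card_UN_le[OF finY])
  also have "\<dots> \<le> (\<Sum>a\<in>Y. g)"
    using fin by (intro sum_mono) (meson card_image_le order_trans)
  also have "\<dots> \<le> Suc l * k * g" using cardY by (simp del: mult_Suc)
  finally show "finite ?R \<and> card ?R \<le> Suc l * k * g"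
    using finite_subset[OF sub finU] by simp
qed

section \<open>Power classes\<close>

text \<open>
  For \<open>m \<ge> 1\<close> the classes consist of the integers in the intervals \<open>[m powr (1 / \<gamma>), (m + 1) powr (1 / \<gamma>))\<close>. Defining them as the
  fibres of \<open>x \<mapsto> \<lfloor>x powr \<gamma>\<rfloor>\<close> makes their disjointness immediate and gives the class of a number
  by a formula.
\<close>

definition power_class :: "real \<Rightarrow> nat \<Rightarrow> int set" where
  "power_class \<gamma> m = {x. 1 \<le> x \<and> nat \<lfloor>real_of_int x powr \<gamma>\<rfloor> = m}"

lemma power_class_eq:
  assumes \<gamma>: "0 < \<gamma>" and m: "1 \<le> m"
  shows "power_class \<gamma> m = {\<lceil>real m powr (1 / \<gamma>)\<rceil>..<\<lceil>(real m + 1) powr (1 / \<gamma>)\<rceil>}"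
proof -
  have inv: "(y powr (1 / \<gamma>) \<le> real_of_int x) \<longleftrightarrow> y \<le> real_of_int x powr \<gamma>"
    if "1 \<le> x" "0 \<le> y" for x :: int and y :: real
  proof
    assume "y powr (1 / \<gamma>) \<le> real_of_int x"
    hence "(y powr (1 / \<gamma>)) powr \<gamma> \<le> real_of_int x powr \<gamma>"
      using \<gamma> by (intro powr_mono2) auto
    thus "y \<le> real_of_int x powr \<gamma>" using \<gamma> that by (simp add: powr_powr)
  next
    assume "y \<le> real_of_int x powr \<gamma>"
    hence "y powr (1 / \<gamma>) \<le> (real_of_int x powr \<gamma>) powr (1 / \<gamma>)"
      using \<gamma> that by (intro powr_mono2) auto
    thus "y powr (1 / \<gamma>) \<le> real_of_int x" using \<gamma> that by (simp add: powr_powr)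
  qed
  have fl: "nat \<lfloor>real_of_int x powr \<gamma>\<rfloor> = m \<longleftrightarrow>
      real m \<le> real_of_int x powr \<gamma> \<and> \<not> real m + 1 \<le> real_of_int x powr \<gamma>" for x :: int
    using m by (simp add: nat_eq_iff floor_eq_iff) linarith
  have pos: "1 \<le> x" if "real m powr (1 / \<gamma>) \<le> real_of_int x" for x :: int
  proof -
    have "1 \<le> real m powr (1 / \<gamma>)" using m \<gamma> by (intro ge_one_powr_ge_zero) auto
    hence "1 \<le> real_of_int x" using that by linarith
    thus ?thesis by simp
  qed
  show ?thesis
  proof (intro set_eqI)
    fix x :: int
    have "x \<in> power_class \<gamma> m \<longleftrightarrow> 1 \<le> x \<and> real m powr (1 / \<gamma>) \<le> real_of_int x \<and>
        \<not> (real m + 1) powr (1 / \<gamma>) \<le> real_of_int x"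
      using inv[of x "real m"] inv[of x "real m + 1"] by (auto simp: power_class_def fl)
    also have "\<dots> \<longleftrightarrow> x \<in> {\<lceil>real m powr (1 / \<gamma>)\<rceil>..<\<lceil>(real m + 1) powr (1 / \<gamma>)\<rceil>}"
      using pos[of x] by (auto simp: ceiling_le_iff less_ceiling_iff)
    finally show "x \<in> power_class \<gamma> m \<longleftrightarrow>
      x \<in> {\<lceil>real m powr (1 / \<gamma>)\<rceil>..<\<lceil>(real m + 1) powr (1 / \<gamma>)\<rceil>}" .
  qed
qed

text \<open>
  The ceilings cost at most 1, and the mean value theorem gives the exact length at least
  \<open>2 * m powr (1 / \<gamma> - 1)\<close>, because the exponent \<open>1 / \<gamma>\<close> is at least 2; the loss is thus absorbed
  by half of the main term.
\<close>

lemma card_power_class_ge: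
  assumes \<gamma>: "0 < \<gamma>" "\<gamma> \<le> 1 / 2" and m: "1 \<le> m"
  shows "real m powr (1 / \<gamma> - 1) \<le> real (card (power_class \<gamma> m))"
proof -
  define \<beta> where "\<beta> = 1 / \<gamma>"
  have \<beta>: "2 \<le> \<beta>" using \<gamma> by (simp add: \<beta>_def field_simps)
  obtain z where z: "real m < z" "z < real m + 1"
    "(real m + 1) powr \<beta> - real m powr \<beta> = (real m + 1 - real m) * (\<beta> * z powr (\<beta> - 1))"
    using MVT2[of "real m" "real m + 1" "\<lambda>x. x powr \<beta>" "\<lambda>x. \<beta> * x powr (\<beta> - 1)"] m
    by (force intro: has_real_derivative_powr)
  have "1 \<le> real m powr (\<beta> - 1)" using m \<beta> by (intro ge_one_powr_ge_zero) auto
  moreover have "real m powr (\<beta> - 1) \<le> z powr (\<beta> - 1)" using z \<beta> by (intro powr_mono2) auto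
  moreover have "2 * z powr (\<beta> - 1) \<le> \<beta> * z powr (\<beta> - 1)" using \<beta> by (intro mult_right_mono) auto
  ultimately have "real m powr (\<beta> - 1) \<le> (real m + 1) powr \<beta> - real m powr \<beta> - 1"
    using z(3) by simp
  also have "\<dots> \<le> real_of_int (\<lceil>(real m + 1) powr \<beta>\<rceil> - \<lceil>real m powr \<beta>\<rceil>)" by linarith
  also have "\<dots> \<le> real (card (power_class \<gamma> m))"
    by (simp add: power_class_eq[OF \<gamma>(1) m] \<beta>_def)
  finally show ?thesis by (simp add: \<beta>_def)
qed

lemma finite_power_class: "0 < \<gamma> \<Longrightarrow> 1 \<le> m \<Longrightarrow> finite (power_class \<gamma> m)"
  by (simp add: power_class_eq)

lemma power_class_nonempty: "0 < \<gamma> \<Longrightarrow> \<gamma> \<le> 1 / 2 \<Longrightarrow> 1 \<le> m \<Longrightarrow> power_class \<gamma> m \<noteq> {}"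
  using card_power_class_ge[of \<gamma> m] by (auto simp: powr_le_iff)

lemma class_index_pos:
  assumes "0 < \<gamma>" "1 \<le> (x::int)"
  shows "1 \<le> nat \<lfloor>real_of_int x powr \<gamma>\<rfloor>"
proof -
  have "1 \<le> real_of_int x powr \<gamma>" using assms by (intro ge_one_powr_ge_zero) auto
  thus ?thesis by (simp add: le_nat_iff le_floor_iff)
qed

text \<open>
  The probability that \<open>x\<close> is the element drawn from its class.
\<close>

definition class_weight :: "real \<Rightarrow> int \<Rightarrow> real" where
  "class_weight \<gamma> x = 1 / real (card (power_class \<gamma> (nat \<lfloor>real_of_int x powr \<gamma>\<rfloor>)))"

lemma class_weight_nonneg: "0 \<le> class_weight \<gamma> x"
  by (simp add: class_weight_def)

text \<open>
  An element \<open>x\<close> of class \<open>m\<close> has \<open>x powr \<gamma> < m + 1 \<le> 2 * m\<close>, so the lower bound on the size of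
  its class can be expressed by \<open>x\<close>.
\<close>

lemma class_weight_le:
  assumes \<gamma>: "0 < \<gamma>" "\<gamma> \<le> 1 / 2" and x: "1 \<le> x"
  shows "class_weight \<gamma> x \<le> 2 powr (1 / \<gamma> - 1) * real_of_int x powr (\<gamma> - 1)"
proof -
  define m where "m = nat \<lfloor>real_of_int x powr \<gamma>\<rfloor>"
  define b where "b = 1 / \<gamma> - 1"
  have m: "1 \<le> m" unfolding m_def by (rule class_index_pos[OF \<gamma>(1) x])
  have b: "0 < b" using \<gamma> by (simp add: b_def field_simps)
  have "real_of_int x powr \<gamma> \<le> 2 * real m" using m unfolding m_def by linarith
  hence "(real_of_int x powr \<gamma>) powr b \<le> (2 * real m) powr b" using b by (intro powr_mono2) auto
  also have "\<dots> = 2 powr b * real m powr b" by (simp add: powr_mult)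
  also have "\<dots> \<le> 2 powr b * real (card (power_class \<gamma> m))"
    using card_power_class_ge[OF \<gamma> m] by (intro mult_left_mono) (auto simp: b_def)
  finally have *: "(real_of_int x powr \<gamma>) powr b \<le> 2 powr b * real (card (power_class \<gamma> m))" .
  have "(real_of_int x powr \<gamma>) powr b = real_of_int x powr (1 - \<gamma>)"
    using \<gamma> by (simp add: powr_powr b_def right_diff_distrib)
  moreover have "real_of_int x powr (1 - \<gamma>) * real_of_int x powr (\<gamma> - 1) = 1"
    using x by (simp flip: powr_add)
  moreover have "0 < real_of_int x powr (\<gamma> - 1)" "0 < real (card (power_class \<gamma> m))"
    using x power_class_nonempty[OF \<gamma> m] finite_power_class[OF \<gamma>(1) m]
    by (auto simp: card_gt_0_iff)
  ultimately have "1 \<le> 2 powr b * real (card (power_class \<gamma> m)) * real_of_int x powr (\<gamma> - 1)"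
    using * by (metis mult_le_cancel_right_pos)
  thus ?thesis using \<open>0 < real (card (power_class \<gamma> m))\<close>
    unfolding class_weight_def m_def[symmetric] b_def[symmetric]
    by (simp add: divide_le_eq ac_simps)
qed

text \<open>
  The weights of each class add up to 1, so the sum is at most the number of classes that meet \<open>{1..n}\<close>.
\<close>

lemma sum_class_weight_le:
  assumes \<gamma>: "0 < \<gamma>"
  shows "(\<Sum>x\<in>{1..n}. class_weight \<gamma> x) \<le> real_of_int n powr \<gamma>"
proof -
  define idx where "idx x = nat \<lfloor>real_of_int x powr \<gamma>\<rfloor>" for x :: int
  have im: "idx ` {1..n} \<subseteq> {1..idx n}"
    using class_index_pos[OF \<gamma>] \<gamma>
    by (auto simp: idx_def intro!: nat_mono floor_mono powr_mono2)
  have "(\<Sum>x\<in>{1..n}. class_weight \<gamma> x) =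
      (\<Sum>m\<in>{1..idx n}. \<Sum>x\<in>{x. x \<in> {1..n} \<and> idx x = m}. class_weight \<gamma> x)"
    by (rule sum.group[OF _ _ im, symmetric]) auto
  also have "\<dots> \<le> (\<Sum>m\<in>{1..idx n}. 1)"
  proof (rule sum_mono)
    fix m assume m: "m \<in> {1..idx n}"
    let ?F = "{x. x \<in> {1..n} \<and> idx x = m}"
    have fin: "finite (power_class \<gamma> m)" using m \<gamma> by (intro finite_power_class) auto
    have "?F \<subseteq> power_class \<gamma> m" by (auto simp: power_class_def idx_def)
    hence c: "card ?F \<le> card (power_class \<gamma> m)" by (rule card_mono[OF fin])
    have "(\<Sum>x\<in>?F. class_weight \<gamma> x) = (\<Sum>x\<in>?F. 1 / real (card (power_class \<gamma> m)))"
      by (intro sum.cong refl) (auto simp: class_weight_def idx_def)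
    also have "\<dots> = real (card ?F) / real (card (power_class \<gamma> m))" by simp
    also have "\<dots> \<le> 1" using c by (cases "card (power_class \<gamma> m) = 0") (auto simp: divide_le_eq_1)
    finally show "(\<Sum>x\<in>?F. class_weight \<gamma> x) \<le> 1" .
  qed
  also have "\<dots> = real (idx n)" by simp
  also have "\<dots> \<le> real_of_int n powr \<gamma>" by (simp add: idx_def of_nat_floor)
  finally show ?thesis .
qed

text \<open>
  The largest entry contributes \<open>n powr (\<gamma> - 1)\<close> and each of the \<open>l - 1\<close> others contributes
  \<open>n powr \<gamma>\<close>. With \<open>\<gamma> = 1 / h - \<epsilon>\<close>, the resulting exponent is below \<open>- 1 / h\<close> for \<open>l < h\<close> and
  equal to \<open>- h * \<epsilon>\<close> for \<open>l = h\<close>.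
\<close>

lemma sum_class_weight_reps_le:
  assumes \<gamma>: "0 < \<gamma>" "\<gamma> \<le> 1 / 2"
  shows "\<exists>C>0. \<forall>l\<in>{1..h}. \<forall>n\<ge>1. (\<Sum>as\<in>reps l {1..n} n. \<Prod>x\<in>set as. class_weight \<gamma> x)
           \<le> C * real_of_int n powr (real l * \<gamma> - 1)"
proof (intro exI conjI ballI allI impI)
  define c where "c = 2 powr (1 / \<gamma> - 1)"
  \<comment> \<open>The summand 1 keeps the constant positive when \<open>h = 0\<close>.\<close>
  let ?C = "real h * (c * real h) * (1 + real h) ^ h + 1"
  have c0: "0 < c" by (simp add: c_def)
  show "0 < ?C" using c0 by (intro add_nonneg_pos mult_nonneg_nonneg) auto
  fix l :: nat and n :: int
  assume l: "l \<in> {1..h}" and n: "1 \<le> n"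
  define t where "t = c * real h * real_of_int n powr (\<gamma> - 1)"
  define y where "y = real_of_int n powr \<gamma>"
  have y1: "1 \<le> y" using n \<gamma> unfolding y_def by (intro ge_one_powr_ge_zero) auto
  have t0: "0 \<le> t" using c0 by (simp add: t_def)
  have top: "class_weight \<gamma> x \<le> t" if x: "1 \<le> x" "x \<le> n" "n \<le> int l * x" for x
  proof -
    have "real_of_int n \<le> real_of_int (int l * x)" using x(3) of_int_le_iff by blast
    hence "real_of_int n / real l \<le> real_of_int x"
      using l by (simp add: divide_le_eq mult.commute)
    hence "real_of_int x powr (\<gamma> - 1) \<le> (real_of_int n / real l) powr (\<gamma> - 1)"
      using \<gamma> n l by (intro powr_mono2') auto
    also have "\<dots> = real_of_int n powr (\<gamma> - 1) * real l powr (1 - \<gamma>)"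
      using n l by (simp add: powr_divide powr_minus_divide[of "real l" "1 - \<gamma>", simplified] field_simps
          flip: powr_add)
    also have "\<dots> \<le> real_of_int n powr (\<gamma> - 1) * real h"
    proof (intro mult_left_mono)
      have "real l powr (1 - \<gamma>) \<le> real l powr 1" using l \<gamma> by (intro powr_mono) auto
      thus "real l powr (1 - \<gamma>) \<le> real h" using l by simp
    qed simp
    finally have "c * real_of_int x powr (\<gamma> - 1) \<le> t"
      using c0 by (simp add: t_def ac_simps)
    thus ?thesis using class_weight_le[OF \<gamma> x(1)] by (simp add: c_def)
  qed
  have "(\<Sum>as\<in>reps l {1..n} n. \<Prod>x\<in>set as. class_weight \<gamma> x)
      \<le> real l * t * ((\<Sum>x\<in>{1..n}. class_weight \<gamma> x) + real l) ^ (l - 1)"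
    using n l top by (intro sum_prod_set_reps class_weight_nonneg) auto
  also have "\<dots> \<le> real h * t * ((1 + real h) * y) ^ (l - 1)"
  proof (intro mult_mono power_mono mult_right_mono)
    have "real l \<le> real h * y" using l y1 mult_mono[of "real l" "real h" 1 y] by simp
    thus "(\<Sum>x\<in>{1..n}. class_weight \<gamma> x) + real l \<le> (1 + real h) * y"
      using sum_class_weight_le[OF \<gamma>(1), of n] by (simp add: y_def distrib_right)
  qed (use l t0 in \<open>auto intro!: zero_le_power add_nonneg_nonneg sum_nonneg class_weight_nonneg\<close>)
  also have "\<dots> = real h * (c * real h) * (1 + real h) ^ (l - 1)
      * (real_of_int n powr (\<gamma> - 1) * y ^ (l - 1))"
    by (simp add: t_def power_mult_distrib ac_simps)
  also have "real_of_int n powr (\<gamma> - 1) * y ^ (l - 1) = real_of_int n powr (real l * \<gamma> - 1)"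
  proof -
    have "y ^ (l - 1) = real_of_int n powr (\<gamma> * real (l - 1))"
      using n by (simp add: y_def powr_powr flip: powr_realpow)
    thus ?thesis using l by (simp add: of_nat_diff algebra_simps flip: powr_add)
  qed
  also have "real h * (c * real h) * (1 + real h) ^ (l - 1) * real_of_int n powr (real l * \<gamma> - 1)
      \<le> ?C * real_of_int n powr (real l * \<gamma> - 1)"
  proof (intro mult_right_mono)
    have "(1 + real h) ^ (l - 1) \<le> (1 + real h) ^ h" using l by (intro power_increasing) auto
    hence "real h * (c * real h) * (1 + real h) ^ (l - 1) \<le> real h * (c * real h) * (1 + real h) ^ h"
      using c0 by (intro mult_left_mono) auto
    thus "real h * (c * real h) * (1 + real h) ^ (l - 1) \<le> ?C" by simp
  qed simp
  finally show "(\<Sum>as\<in>reps l {1..n} n. \<Prod>x\<in>set as. class_weight \<gamma> x)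
      \<le> ?C * real_of_int n powr (real l * \<gamma> - 1)" .
qed

section \<open>The random sequence\<close>

lemma member_le_sum_list_int:
  fixes as :: "int list"
  shows "(\<And>x. x \<in> set as \<Longrightarrow> 0 \<le> x) \<Longrightarrow> y \<in> set as \<Longrightarrow> y \<le> sum_list as"
proof (induction as)
  case (Cons a as)
  have "0 \<le> sum_list as" using Cons.prems(1) by (intro sum_list_nonneg) auto
  thus ?case using Cons by fastforce
qed simp

lemma finite_reps: "finite U \<Longrightarrow> finite (reps l U n)"
  by (rule finite_subset[OF _ finite_lists_length_eq[of U l]]) (auto simp: reps_def)

text \<open>
  Disjointness turns the weight of the union into the product of the weights; dropping the
  disjointness condition afterwards leaves a full power.
\<close>

lemma sum_disjoint_tuples_le:
  fixes p :: "'a \<Rightarrow> real"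
  assumes fin: "finite R" and p: "\<And>x. 0 \<le> p x"
  shows "(\<Sum>d | d \<in> {..<k} \<rightarrow>\<^sub>E R \<and> disjoint_family_on (\<lambda>i. set (d i)) {..<k}.
            \<Prod>x\<in>(\<Union>i<k. set (d i)). p x) \<le> (\<Sum>as\<in>R. \<Prod>x\<in>set as. p x) ^ k"
proof -
  let ?D = "{d. d \<in> {..<k} \<rightarrow>\<^sub>E R \<and> disjoint_family_on (\<lambda>i. set (d i)) {..<k}}"
  have "(\<Sum>d\<in>?D. \<Prod>x\<in>(\<Union>i<k. set (d i)). p x) = (\<Sum>d\<in>?D. \<Prod>i<k. \<Prod>x\<in>set (d i). p x)"
    by (intro sum.cong prod.UNION_disjoint refl) (auto simp: disjoint_family_on_def)
  also have "\<dots> \<le> (\<Sum>d\<in>{..<k} \<rightarrow>\<^sub>E R. \<Prod>i<k. \<Prod>x\<in>set (d i). p x)"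
    using fin p by (intro sum_mono2 finite_PiE) (auto intro!: prod_nonneg)
  also have "\<dots> = (\<Prod>i<k. \<Sum>as\<in>R. \<Prod>x\<in>set as. p x)"
    using fin by (intro prod_sum_PiE[symmetric]) auto
  finally show ?thesis by simp
qed

text \<open>
  The expected number of disjoint \<open>k l\<close>-tuples of representations of \<open>n\<close> is at most a constant
  times \<open>n powr (- real (k l) * (1 - l * \<gamma>))\<close>, and the hypothesis on \<open>k\<close> makes this
  \<open>O(n powr - 3)\<close>. The sum over all \<open>n \<ge> N\<close> is below 1 once \<open>N\<close> is large, so some choice
  \<open>\<omega>\<close> avoids every such tuple.
\<close>

lemma exists_transversal_few_disjoint_reps:
  assumes \<gamma>: "0 < \<gamma>" "\<gamma> \<le> 1 / 2"
    and k: "\<forall>l\<in>{1..h}. 3 \<le> real (k l) * (1 - real l * \<gamma>)"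
  shows "\<exists>\<omega> N. 1 \<le> N \<and> (\<forall>m\<ge>1. \<omega> m \<in> power_class \<gamma> m) \<and>
           (\<forall>l\<in>{1..h}. \<forall>n\<ge>int N. \<forall>d. (\<forall>i<k l. d i \<in> reps l {1..n} n) \<longrightarrow>
              disjoint_family_on (\<lambda>i. set (d i)) {..<k l} \<longrightarrow>
              (\<exists>i<k l. \<exists>x\<in>set (d i). \<omega> (nat \<lfloor>real_of_int x powr \<gamma>\<rfloor>) \<noteq> x))"
proof -
  define idx where "idx x = nat \<lfloor>real_of_int x powr \<gamma>\<rfloor>" for x :: int
  define P where "P m = pmf_of_set (power_class \<gamma> m)" for m
  let ?p = "class_weight \<gamma>"
  obtain C where C: "0 < C" "\<And>l n. l \<in> {1..h} \<Longrightarrow> 1 \<le> n \<Longrightarrow>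
      (\<Sum>as\<in>reps l {1..n} n. \<Prod>x\<in>set as. ?p x) \<le> C * real_of_int n powr (real l * \<gamma> - 1)"
    using sum_class_weight_reps_le[OF \<gamma>, of h] by blast
  define B where "B = (\<Sum>l\<in>{1..h}. C ^ k l)"
  have "summable (\<lambda>n. B * real n powr (-3))"
    by (intro summable_mult) (simp add: summable_real_powr_iff)
  then obtain N0 where N0: "\<And>n. N0 \<le> n \<Longrightarrow> norm (\<Sum>i. B * real (i + n) powr (-3)) < 1"
    using suminf_exist_split[of 1 "\<lambda>n. B * real n powr (-3)"] by auto
  define N where "N = max N0 1"
  define w where "w n = B * real (n + N) powr (-3)" for n
  have w: "summable w" "suminf w < 1"
  proof -
    show "summable w" unfolding w_def
      using summable_iff_shift[of "\<lambda>n. B * real n powr (-3)" N]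
        \<open>summable (\<lambda>n. B * real n powr (-3))\<close> by simp
    show "suminf w < 1" using N0[of N] unfolding w_def[abs_def] N_def by simp
  qed
  define T where "T l n = {d. d \<in> {..<k l} \<rightarrow>\<^sub>E reps l {1..n} n \<and>
      disjoint_family_on (\<lambda>i. set (d i)) {..<k l}}" for l :: nat and n :: int
  \<comment> \<open>Packets are shifted by \<open>N\<close>, so that their series is the tail of a convergent one.\<close>
  define D where "D n = (SIGMA l:{1..h}. T l (int (n + N)))" for n :: nat
  define X where "X ld = (\<Union>i<k (fst ld). set (snd ld i))" for ld :: "nat \<times> (nat \<Rightarrow> int list)"
  have finT: "finite (T l n)" for l n
    by (rule finite_subset[of _ "{..<k l} \<rightarrow>\<^sub>E reps l {1..n} n"])
      (auto simp: T_def intro!: finite_PiE finite_reps)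
  have pmf: "pmf (P (idx x)) x = ?p x" if "1 \<le> x" for x
  proof -
    have "1 \<le> idx x" unfolding idx_def by (rule class_index_pos[OF \<gamma>(1) that])
    hence "finite (power_class \<gamma> (idx x))" "power_class \<gamma> (idx x) \<noteq> {}"
      using finite_power_class power_class_nonempty \<gamma> by auto
    moreover have "x \<in> power_class \<gamma> (idx x)" using that by (simp add: power_class_def idx_def)
    ultimately show ?thesis by (simp add: P_def class_weight_def idx_def)
  qed
  have bound: "(\<Sum>ld\<in>D n. \<Prod>x\<in>X ld. pmf (P (idx x)) x) \<le> w n" for n
  proof -
    define n' where "n' = int (n + N)"
    have n': "1 \<le> n'" by (simp add: n'_def N_def)
    have "(\<Sum>ld\<in>D n. \<Prod>x\<in>X ld. pmf (P (idx x)) x) = (\<Sum>ld\<in>D n. \<Prod>x\<in>X ld. ?p x)"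
    proof (intro sum.cong prod.cong refl pmf)
      fix ld x assume "ld \<in> D n" "x \<in> X ld"
      thus "1 \<le> x" by (fastforce simp: D_def X_def T_def PiE_iff reps_def)
    qed
    also have "\<dots> = (\<Sum>l\<in>{1..h}. \<Sum>d\<in>T l n'. \<Prod>x\<in>(\<Union>i<k l. set (d i)). ?p x)"
      using finT by (simp add: D_def X_def n'_def sum.Sigma split_def)
    also have "\<dots> \<le> (\<Sum>l\<in>{1..h}. C ^ k l * real_of_int n' powr (-3))"
    proof (rule sum_mono)
      fix l assume l: "l \<in> {1..h}"
      have "(\<Sum>d\<in>T l n'. \<Prod>x\<in>(\<Union>i<k l. set (d i)). ?p x)
          \<le> (\<Sum>as\<in>reps l {1..n'} n'. \<Prod>x\<in>set as. ?p x) ^ k l"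
        unfolding T_def by (intro sum_disjoint_tuples_le finite_reps class_weight_nonneg) auto
      also have "\<dots> \<le> (C * real_of_int n' powr (real l * \<gamma> - 1)) ^ k l"
        by (intro power_mono C(2) l n' sum_nonneg prod_nonneg ballI class_weight_nonneg)
      also have "\<dots> = C ^ k l * real_of_int n' powr (real (k l) * (real l * \<gamma> - 1))"
        using n' by (simp add: power_mult_distrib powr_powr mult.commute flip: powr_realpow)
      also have "\<dots> \<le> C ^ k l * real_of_int n' powr (-3)"
        using bspec[OF k l] C(1) n' by (intro mult_left_mono powr_mono) (auto simp: algebra_simps)
      finally show "(\<Sum>d\<in>T l n'. \<Prod>x\<in>(\<Union>i<k l. set (d i)). ?p x)
          \<le> C ^ k l * real_of_int n' powr (-3)" .
    qed
    also have "\<dots> = w n" by (simp add: w_def B_def n'_def sum_distrib_right)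
    finally show ?thesis .
  qed
  have "\<exists>\<omega>. (\<forall>m. \<omega> m \<in> set_pmf (P m)) \<and> (\<forall>n. \<forall>ld\<in>D n. \<exists>x\<in>X ld. \<omega> (idx x) \<noteq> x)"
    using finT bound w by (intro random_transversal) (auto simp: D_def X_def)
  then obtain \<omega> where \<omega>: "\<And>m. \<omega> m \<in> set_pmf (P m)"
      "\<And>n ld. ld \<in> D n \<Longrightarrow> \<exists>x\<in>X ld. \<omega> (idx x) \<noteq> x" by blast
  show ?thesis
  proof (rule exI[of _ \<omega>], rule exI[of _ N], intro conjI allI ballI impI)
    show "1 \<le> N" by (simp add: N_def)
    show "\<omega> m \<in> power_class \<gamma> m" if "1 \<le> m" for m
      using \<omega>(1)[of m] finite_power_class[OF \<gamma>(1) that] power_class_nonempty[OF \<gamma> that]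
      by (simp add: P_def)
    fix l and n :: int and d :: "nat \<Rightarrow> int list"
    assume l: "l \<in> {1..h}" and n: "int N \<le> n" and d: "\<forall>i<k l. d i \<in> reps l {1..n} n"
      and dis: "disjoint_family_on (\<lambda>i. set (d i)) {..<k l}"
    have n_eq: "n = int (nat n - N + N)" using n by simp
    have "restrict d {..<k l} \<in> T l n"
      using d dis by (auto simp: T_def disjoint_family_on_def)
    hence "(l, restrict d {..<k l}) \<in> D (nat n - N)"
      using l n_eq unfolding D_def by auto
    from \<omega>(2)[OF this] show "\<exists>i<k l. \<exists>x\<in>set (d i). \<omega> (nat \<lfloor>real_of_int x powr \<gamma>\<rfloor>) \<noteq> x"
      by (auto simp: X_def idx_def)
  qed
qed

text \<open>
  The density is not left to chance: each class of index at least \<open>N\<close> that lies below \<open>x\<close>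
  contributes its element, and there are about \<open>x powr \<gamma>\<close> of them.
\<close>

lemma counting_ge_of_transversal:
  fixes N :: nat
  assumes \<gamma>: "0 < \<gamma>" "\<gamma> \<le> 1" and N: "1 \<le> N"
    and \<omega>: "\<And>m. 1 \<le> m \<Longrightarrow> \<omega> m \<in> power_class \<gamma> m"
    and A: "\<And>m. 1 \<le> m \<Longrightarrow> int N \<le> \<omega> m \<Longrightarrow> \<omega> m \<in> A"
  shows "(\<lambda>x. real (counting A x)) \<in> \<Omega>[at_top](\<lambda>x. x powr \<gamma>)"
proof (rule landau_omega.bigI)
  show "(0::real) < 1 / 2" by simp
  show "\<forall>\<^sub>F x in at_top. 1 / 2 * norm (x powr \<gamma>) \<le> norm (real (counting A x))"
  proof (rule eventually_at_top_linorderI)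
    fix x :: real assume x: "real (2 * N + 2) powr (1 / \<gamma>) \<le> x"
    have x0: "0 < x" by (rule less_le_trans[OF _ x]) simp
    have big: "real (2 * N + 2) \<le> x powr \<gamma>"
    proof -
      have "(real (2 * N + 2) powr (1 / \<gamma>)) powr \<gamma> \<le> x powr \<gamma>"
        using x \<gamma> by (intro powr_mono2) auto
      thus ?thesis using \<gamma> by (simp add: powr_powr)
    qed
    define M where "M = nat \<lfloor>x powr \<gamma>\<rfloor>"
    have M: "real M \<le> x powr \<gamma>" "x powr \<gamma> < real M + 1" by (simp_all add: M_def of_nat_floor)
    let ?S = "{a \<in> A. 1 \<le> a \<and> real_of_int a \<le> x}"
    have inj: "inj_on \<omega> {N..<M}"
    proof (rule inj_onI)
      fix i j assume "i \<in> {N..<M}" "j \<in> {N..<M}" "\<omega> i = \<omega> j"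
      thus "i = j" using \<omega>[of i] \<omega>[of j] N by (simp add: power_class_def)
    qed
    have "\<omega> m \<in> ?S" if m: "m \<in> {N..<M}" for m
    proof -
      have m1: "1 \<le> m" using m N by simp
      have b: "\<lceil>real m powr (1 / \<gamma>)\<rceil> \<le> \<omega> m" "\<omega> m < \<lceil>(real m + 1) powr (1 / \<gamma>)\<rceil>"
        using \<omega>[OF m1] unfolding power_class_eq[OF \<gamma>(1) m1] by auto
      have "real m powr 1 \<le> real m powr (1 / \<gamma>)" using m1 \<gamma> by (intro powr_mono) auto
      hence "real m \<le> real_of_int (\<omega> m)" using b(1) m1 by (simp add: ceiling_le_iff)
      hence ge: "int m \<le> \<omega> m" by linarith
      have "(real m + 1) powr (1 / \<gamma>) \<le> (x powr \<gamma>) powr (1 / \<gamma>)"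
        using m M \<gamma> by (intro powr_mono2) auto
      also have "\<dots> = x" using \<gamma> x0 by (simp add: powr_powr)
      finally have "real_of_int (\<omega> m) \<le> x" using b(2) by (simp add: less_ceiling_iff)
      thus ?thesis using A[OF m1] ge m N by auto
    qed
    hence sub: "\<omega> ` {N..<M} \<subseteq> ?S" by blast
    have "finite ?S" by (rule finite_subset[of _ "{1..\<lfloor>x\<rfloor>}"]) (auto simp: le_floor_iff)
    hence "card (\<omega> ` {N..<M}) \<le> counting A x"
      unfolding counting_def using sub by (rule card_mono)
    hence "M - N \<le> counting A x" by (simp add: card_image[OF inj])
    hence "real M - real N \<le> real (counting A x)" by linarith
    thus "1 / 2 * norm (x powr \<gamma>) \<le> norm (real (counting A x))" using big M by simp
  qed
qed

lemma exists_dense_B_seq: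
  assumes \<gamma>: "0 < \<gamma>" "\<gamma> \<le> 1 / 2"
    and k: "\<forall>l\<in>{1..h}. 3 \<le> real (k l) * (1 - real l * \<gamma>)"
  shows "\<exists>A. B_seq h (\<Prod>l=1..h. l * k l) A \<and>
           (\<lambda>x. real (counting A x)) \<in> \<Omega>[at_top](\<lambda>x. x powr \<gamma>)"
proof -
  obtain \<omega> N where N: "1 \<le> N" and "\<forall>m\<ge>1. \<omega> m \<in> power_class \<gamma> m"
    and few: "\<forall>l\<in>{1..h}. \<forall>n\<ge>int N. \<forall>d. (\<forall>i<k l. d i \<in> reps l {1..n} n) \<longrightarrow>
       disjoint_family_on (\<lambda>i. set (d i)) {..<k l} \<longrightarrow>
       (\<exists>i<k l. \<exists>x\<in>set (d i). \<omega> (nat \<lfloor>real_of_int x powr \<gamma>\<rfloor>) \<noteq> x)"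
    using exists_transversal_few_disjoint_reps[OF \<gamma> k] by (elim exE conjE) (rule that)
  hence \<omega>: "\<And>m. 1 \<le> m \<Longrightarrow> \<omega> m \<in> power_class \<gamma> m" by blast
  \<comment> \<open>Discarding the elements below \<open>N\<close> leaves no number below \<open>N\<close> with a representation of positive length.\<close>
  define A where "A = {x. int N \<le> x \<and> \<omega> (nat \<lfloor>real_of_int x powr \<gamma>\<rfloor>) = x}"
  have elem: "int N \<le> x \<and> x \<le> n" if "as \<in> reps l A n" "x \<in> set as" for as l n x
  proof -
    have ge: "int N \<le> y" if "y \<in> set as" for y
      using that \<open>as \<in> reps l A n\<close> by (auto simp: reps_def A_def)
    have "x \<le> sum_list as"
    proof (rule member_le_sum_list_int)
      show "0 \<le> y" if "y \<in> set as" for y using ge[OF that] by simp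
    qed (rule that(2))
    moreover have "sum_list as = n" using that(1) by (simp add: reps_def)
    ultimately show ?thesis using ge[OF that(2)] by simp
  qed
  have "B_seq l (\<Prod>i=1..l. i * k i) A" if "l \<le> h" for l
    using that
  proof (induction l)
    case 0
    show ?case using B_seq_0 by simp
  next
    case (Suc l)
    have "B_seq (Suc l) (Suc l * k (Suc l) * (\<Prod>i=1..l. i * k i)) A"
    proof (rule B_seq_Suc)
      show "B_seq l (\<Prod>i=1..l. i * k i) A" using Suc by simp
      fix n d
      assume d: "\<And>i. i < k (Suc l) \<Longrightarrow> d i \<in> reps (Suc l) A n"
        and dis: "\<And>i j. i < k (Suc l) \<Longrightarrow> j < k (Suc l) \<Longrightarrow> i \<noteq> j \<Longrightarrow> set (d i) \<inter> set (d j) = {}"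
      have k0: "0 < k (Suc l)" using bspec[OF k, of "Suc l"] Suc.prems by (intro Nat.gr0I) auto
      hence "d 0 \<noteq> []" using d[of 0] by (auto simp: reps_def)
      hence n: "int N \<le> n" using elem[OF d[OF k0], of "hd (d 0)"] by auto
      have "\<exists>i<k (Suc l). \<exists>x\<in>set (d i). \<omega> (nat \<lfloor>real_of_int x powr \<gamma>\<rfloor>) \<noteq> x"
      proof (rule few[rule_format, OF _ n])
        show "d i \<in> reps (Suc l) {1..n} n" if "i < k (Suc l)" for i
          using d[OF that] elem[OF d[OF that]] N by (force simp: reps_def)
        show "disjoint_family_on (\<lambda>i. set (d i)) {..<k (Suc l)}"
          using dis by (auto simp: disjoint_family_on_def)
      qed (use Suc.prems in auto)
      thus False using d by (force simp: reps_def A_def)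
    qed
    thus ?case by (simp add: mult.commute del: mult_Suc)
  qed
  moreover have "(\<lambda>x. real (counting A x)) \<in> \<Omega>[at_top](\<lambda>x. x powr \<gamma>)"
    using \<gamma> N \<omega>
    by (intro counting_ge_of_transversal[of \<gamma> N \<omega>]) (auto simp: A_def power_class_def)
  ultimately show ?thesis by blast
qed

section \<open>The choice of the parameters\<close>

theorem theorem1p2:
  fixes h :: nat
  assumes "h \<ge> 2"
  shows "\<exists>g :: real \<Rightarrow> nat.
           (\<forall>\<epsilon>>0. g \<epsilon> > 0) \<and>
           (\<lambda>\<epsilon>. real (g \<epsilon>)) \<in> O[at_right 0](\<lambda>\<epsilon>. 1 / \<epsilon>) \<and>
           (\<forall>\<epsilon>>0. \<exists>A :: int set. B_seq h (g \<epsilon>) A \<and>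
              (\<lambda>x. real (counting A x)) \<in> \<Omega>[at_top](\<lambda>x. x powr (1 / real h - \<epsilon>)))"
proof -
  \<comment> \<open>Decreasing \<open>\<epsilon>\<close> only strengthens the lower bound on the counting function. The cap keeps the exponent
    \<open>1 / h - \<delta> \<epsilon>\<close> positive, and it is inactive as \<open>\<epsilon> \<rightarrow> 0\<close>.\<close>
  define \<delta> where "\<delta> \<epsilon> = min \<epsilon> (1 / (2 * real h))" for \<epsilon> :: real
  \<comment> \<open>Only the representations of full length \<open>h\<close> need a number of disjoint copies that grows with
    \<open>1 / \<epsilon>\<close>, so only one factor of \<open>g \<epsilon>\<close> depends on \<open>\<epsilon>\<close>.\<close>
  define k where "k \<epsilon> l = (if l < h then 3 * h else nat \<lceil>3 / (real h * \<delta> \<epsilon>)\<rceil>)" for \<epsilon> l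
  define g where "g \<epsilon> = (\<Prod>l=1..h. l * k \<epsilon> l)" for \<epsilon>
  define c where "c = real (h * (\<Prod>l=1..<h. l * (3 * h)))"
  have g_eq: "real (g \<epsilon>) = c * real (nat \<lceil>3 / (real h * \<delta> \<epsilon>)\<rceil>)" for \<epsilon>
  proof -
    have "{1..h} = insert h {1..<h}" using assms by auto
    thus ?thesis by (simp add: g_def k_def c_def)
  qed
  have \<delta>: "0 < \<delta> \<epsilon>" "\<delta> \<epsilon> \<le> 1 / (2 * real h)" "\<delta> \<epsilon> \<le> \<epsilon>" if "0 < \<epsilon>" for \<epsilon>
    using that assms by (auto simp: \<delta>_def)
  have c0: "0 < c" unfolding c_def of_nat_0_less_iff using assms by (intro mult_pos_pos prod_pos) auto
  show ?thesis
  proof (intro exI[of _ g] conjI allI impI)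
    fix \<epsilon> :: real assume \<epsilon>: "0 < \<epsilon>"
    have "0 < 3 / (real h * \<delta> \<epsilon>)" using \<delta>(1)[OF \<epsilon>] assms by simp
    hence "0 < real (g \<epsilon>)" unfolding g_eq using c0 by simp
    thus "0 < g \<epsilon>" by simp
    define \<gamma> where "\<gamma> = 1 / real h - \<delta> \<epsilon>"
    have half: "1 / (2 * real h) < 1 / real h" "1 / real h \<le> 1 / 2"
      using assms by (auto simp: field_simps)
    have \<gamma>: "0 < \<gamma>" "\<gamma> \<le> 1 / 2" using \<delta>[OF \<epsilon>] half by (auto simp: \<gamma>_def)
    have "3 \<le> real (k \<epsilon> l) * (1 - real l * \<gamma>)" if l: "1 \<le> l" "l \<le> h" for l
    proof (cases "l < h")
      case True
      have "real l * \<gamma> \<le> (real h - 1) * (1 / real h)"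
        using True \<gamma>(1) \<delta>(1)[OF \<epsilon>] by (intro mult_mono) (auto simp: \<gamma>_def)
      also have "\<dots> = 1 - 1 / real h" using assms by (simp add: field_simps)
      finally have "real (3 * h) * (1 / real h) \<le> real (3 * h) * (1 - real l * \<gamma>)"
        by (intro mult_left_mono) auto
      thus ?thesis using True assms by (simp add: k_def)
    next
      case False
      hence "l = h" using l by simp
      have "1 - real h * \<gamma> = real h * \<delta> \<epsilon>" using assms by (simp add: \<gamma>_def right_diff_distrib)
      moreover have "3 / (real h * \<delta> \<epsilon>) \<le> real (k \<epsilon> h)" by (simp add: k_def real_nat_ceiling_ge)
      ultimately show ?thesis using \<delta>(1)[OF \<epsilon>] assms \<open>l = h\<close> by (simp add: divide_le_eq)
    qed
    then obtain A where A: "B_seq h (g \<epsilon>) A"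
        "(\<lambda>x. real (counting A x)) \<in> \<Omega>[at_top](\<lambda>x. x powr \<gamma>)"
      using exists_dense_B_seq[OF \<gamma>, of h "k \<epsilon>"] unfolding g_def by auto
    have "(\<lambda>x::real. x powr \<gamma>) \<in> \<Omega>[at_top](\<lambda>x. x powr (1 / real h - \<epsilon>))"
    proof (rule landau_omega.bigI[of 1])
      show "\<forall>\<^sub>F x::real in at_top. 1 * norm (x powr (1 / real h - \<epsilon>)) \<le> norm (x powr \<gamma>)"
        using \<delta>(3)[OF \<epsilon>]
        by (intro eventually_at_top_linorderI[of 1]) (auto simp: \<gamma>_def intro!: powr_mono)
    qed simp
    with A(2) have "(\<lambda>x. real (counting A x)) \<in> \<Omega>[at_top](\<lambda>x. x powr (1 / real h - \<epsilon>))"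
      by (rule landau_omega.big_trans)
    with A(1) show "\<exists>A. B_seq h (g \<epsilon>) A \<and>
        (\<lambda>x. real (counting A x)) \<in> \<Omega>[at_top](\<lambda>x. x powr (1 / real h - \<epsilon>))" by blast
  next
    show "(\<lambda>\<epsilon>. real (g \<epsilon>)) \<in> O[at_right 0](\<lambda>\<epsilon>. 1 / \<epsilon>)"
    proof (rule bigoI[where c = "4 * c"])
      have "\<forall>\<^sub>F \<epsilon> in at_right 0. \<epsilon> < 1 / (2 * real h) \<and> (0::real) < \<epsilon>"
        using assms by (intro eventually_conj eventually_at_right_less)
          (auto intro!: eventually_at_rightI[of 0 "1 / (2 * real h)"])
      thus "\<forall>\<^sub>F \<epsilon> in at_right 0. norm (real (g \<epsilon>)) \<le> 4 * c * norm (1 / \<epsilon>)"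
      proof eventually_elim
        case (elim \<epsilon>)
        hence e: "\<delta> \<epsilon> = \<epsilon>" "0 < \<epsilon>" by (auto simp: \<delta>_def)
        have "\<epsilon> * 1 \<le> \<epsilon> * real h" using e assms by (intro mult_left_mono) auto
        hence "3 / (real h * \<epsilon>) \<le> 3 / \<epsilon>" using e assms by (intro divide_left_mono) (auto simp: mult.commute)
        moreover have "1 / (2 * real h) \<le> 1" using assms by (simp add: field_simps)
        hence "1 \<le> 1 / \<epsilon>" using elim by (simp add: field_simps)
        moreover have "0 \<le> 3 / (real h * \<epsilon>)" using e by simp
        hence "real (nat \<lceil>3 / (real h * \<epsilon>)\<rceil>) \<le> 3 / (real h * \<epsilon>) + 1" by linarith
        ultimately have "real (nat \<lceil>3 / (real h * \<epsilon>)\<rceil>) \<le> 4 / \<epsilon>" by simp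
        hence "c * real (nat \<lceil>3 / (real h * \<epsilon>)\<rceil>) \<le> c * (4 / \<epsilon>)" using c0 by (intro mult_left_mono) auto
        hence "real (g \<epsilon>) \<le> 4 * c * (1 / \<epsilon>)" using e by (simp add: g_eq ac_simps)
        thus ?case using e by simp
      qed
    qed
  qed
qed

end
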